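(* For all integers $m\ge 1$ and $n\ge 2$, the Alon--Tarsi number of the toroidal grid $T_{2m+1,2n}=C_{2m+1}\Box C_{2n}$ equals $3$.
   Context: For a graph $G$ with vertices $1,\ldots,n$, its graph polynomial is $f_G(x_1,\ldots,x_n)=\prod_{1\le i<j\le n,\ ij\in E(G)}(x_i-x_j)$. $G$ is Alon--Tarsi $k$-choosable if the expansion of $f_G$ (over $\mathbb{R}$) contains a monomial $c\prod_i x_i^{t_i}$ with $c\ne 0$ and $t_i\le k-1$ for all $i$; the Alon--Tarsi number $AT(G)$ is the smallest such $k$. $C_k$ is the cycle on $k$ vertices and $\Box$ is the Cartesian product of graphs; $T_{a,b}=C_a\Box C_b$. *)

theory Defs
  imports
    Complex_Main
    "HOL-Library.Poly_Mapping"
    "HOL-Library.Product_Lexorder"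
    "Graph_Theory.Pair_Digraph"
begin

text \<open>
  A finite simple graph is a \<^const>\<open>pair_graph\<close>: a finite digraph without loops whose set of arcs
  is symmetric, an edge \<open>uv\<close> being represented by the two arcs \<open>(u, v)\<close> and \<open>(v, u)\<close>.
\<close>

text \<open>
  Real polynomials in indeterminates indexed by \<^typ>\<open>'v\<close>: a monomial \<open>t :: 'v \<Rightarrow>\<^sub>0 nat\<close> is its
  exponent vector, and \<open>lookup p t\<close> is the coefficient of \<open>t\<close> in the expansion of \<open>p\<close>.
\<close>

type_synonym 'v real_mpoly = "('v \<Rightarrow>\<^sub>0 nat) \<Rightarrow>\<^sub>0 real"

definition mvar :: "'v \<Rightarrow> 'v real_mpoly" where
  "mvar v = Poly_Mapping.single (Poly_Mapping.single v 1) 1"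

text \<open>
  A linear order on the vertices plays the role of their numbering \<open>1, \<dots>, n\<close>; of the two arcs of
  an edge exactly one increases. Vertices of Cartesian products are ordered lexicographically.
\<close>

definition graph_polynomial :: "'v::linorder pair_pre_digraph \<Rightarrow> 'v real_mpoly" where
  "graph_polynomial G = (\<Prod>(u, v) \<in> {(u, v) \<in> parcs G. u < v}. mvar u - mvar v)"

text \<open>\<open>t\<^sub>v < k\<close> rather than \<open>t\<^sub>v \<le> k - 1\<close>, because of the truncated subtraction for \<open>k = 0\<close>.\<close>

definition alon_tarsi_choosable :: "nat \<Rightarrow> 'v::linorder pair_pre_digraph \<Rightarrow> bool" where
  "alon_tarsi_choosable k G \<longleftrightarrow>
     (\<exists>t. Poly_Mapping.lookup (graph_polynomial G) t \<noteq> 0 \<and>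
          (\<forall>v \<in> pverts G. Poly_Mapping.lookup t v < k))"

definition alon_tarsi_number :: "'v::linorder pair_pre_digraph \<Rightarrow> nat" where
  "alon_tarsi_number G = (LEAST k. alon_tarsi_choosable k G)"

text \<open>This is the cycle on \<open>k\<close> vertices for \<open>k \<ge> 3\<close> only; for \<open>k = 1\<close> it has a loop.\<close>

definition cycle_graph :: "nat \<Rightarrow> nat pair_pre_digraph" where
  "cycle_graph k =
     \<lparr> pverts = {0..<k},
       parcs = {(i, j). i < k \<and> j < k \<and> (j = (i + 1) mod k \<or> i = (j + 1) mod k)} \<rparr>"

definition cartesian_product ::
    "'a pair_pre_digraph \<Rightarrow> 'b pair_pre_digraph \<Rightarrow> ('a \<times> 'b) pair_pre_digraph" where
  "cartesian_product G H =
     \<lparr> pverts = pverts G \<times> pverts H,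
       parcs = {((u, v), (u', v')).
         (u = u' \<and> u \<in> pverts G \<and> (v, v') \<in> parcs H) \<or>
         (v = v' \<and> v \<in> pverts H \<and> (u, u') \<in> parcs G)} \<rparr>"

definition toroidal_grid :: "nat \<Rightarrow> nat \<Rightarrow> (nat \<times> nat) pair_pre_digraph" where
  "toroidal_grid a b = cartesian_product (cycle_graph a) (cycle_graph b)"

lemma pair_graph_cycle_graph:
  assumes "k \<ge> 3"
  shows "pair_graph (cycle_graph k)"
proof
  have "parcs (cycle_graph k) \<subseteq> {0..<k} \<times> {0..<k}"
    by (auto simp: cycle_graph_def)
  then show "finite (parcs (cycle_graph k))"
    by (rule finite_subset) simp
  show "symmetric (with_proj (cycle_graph k))"
    by (auto simp: symmetric_def cycle_graph_def intro!: symI)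
next
  fix e assume "e \<in> parcs (cycle_graph k)"
  moreover have "i \<noteq> (i + 1) mod k" if "i < k" for i
    using assms that by (cases "i + 1 = k") auto
  ultimately show "fst e \<noteq> snd e"
    by (fastforce simp: cycle_graph_def)
qed (auto simp: cycle_graph_def)

lemma pair_graph_cartesian_product:
  assumes "pair_graph G" "pair_graph H"
  shows "pair_graph (cartesian_product G H)"
proof -
  interpret G: pair_graph G by fact
  interpret H: pair_graph H by fact
  have sub: "parcs (cartesian_product G H) \<subseteq>
    (pverts G \<times> pverts H) \<times> (pverts G \<times> pverts H)"
    by (auto simp: cartesian_product_def dest: G.wellformed' H.wellformed')
  show ?thesis
  proof
    show "finite (parcs (cartesian_product G H))"
      using sub by (rule finite_subset) (simp add: G.pair_finite_verts H.pair_finite_verts)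
    show "symmetric (with_proj (cartesian_product G H))"
      using G.pair_sym_arcs H.pair_sym_arcs
      by (auto simp: symmetric_def cartesian_product_def intro!: symI dest: symD)
    show "finite (pverts (cartesian_product G H))"
      by (simp add: cartesian_product_def G.pair_finite_verts H.pair_finite_verts)
    fix e assume e: "e \<in> parcs (cartesian_product G H)"
    show "fst e \<noteq> snd e"
      using e by (auto simp: cartesian_product_def dest: G.pair_no_loops H.pair_no_loops)
    show "fst e \<in> pverts (cartesian_product G H)" "snd e \<in> pverts (cartesian_product G H)"
      using subsetD[OF sub e] by (auto simp: cartesian_product_def)
  qed
qed

text \<open>The minimum defining the Alon-Tarsi number of a finite simple graph exists.\<close>

lemma alon_tarsi_choosable_exists:
  fixes G :: "'v::linorder pair_pre_digraph"
  assumes "pair_graph G"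
  shows "\<exists>k. alon_tarsi_choosable k G"
proof -
  interpret pair_graph G by fact
  have neq: "mvar u - mvar v \<noteq> 0" if "u < v" for u v :: 'v
  proof
    assume "mvar u - mvar v = 0"
    then have "Poly_Mapping.lookup (mvar u) (Poly_Mapping.single u 1) =
        Poly_Mapping.lookup (mvar v) (Poly_Mapping.single u 1)"
      by simp
    moreover have "Poly_Mapping.single v (1::nat) \<noteq> Poly_Mapping.single u 1"
      using that by (metis lookup_single_eq lookup_single_not_eq less_irrefl zero_neq_one)
    ultimately show False
      by (simp add: mvar_def lookup_single when_def)
  qed
  have "finite {(u, v) \<in> parcs G. u < v}"
    using pair_finite_arcs by (rule rev_finite_subset) auto
  then have "graph_polynomial G \<noteq> 0"
    using neq by (auto simp: graph_polynomial_def prod_zero_iff)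
  then obtain t where t: "Poly_Mapping.lookup (graph_polynomial G) t \<noteq> 0"
    by (metis lookup_zero poly_mapping_eqI)
  have "\<forall>v \<in> pverts G. Poly_Mapping.lookup t v < Suc (\<Sum>w\<in>pverts G. Poly_Mapping.lookup t w)"
    using pair_finite_verts by (auto simp: less_Suc_eq_le intro: member_le_sum)
  with t show ?thesis
    unfolding alon_tarsi_choosable_def by blast
qed

end

theory Submission
  imports Defs
begin

text \<open>
  The graph polynomial is homogeneous of degree twice the number of vertices, so every monomial has
  an exponent \<open>\<ge> 2\<close>, and only the monomial \<open>t\<close> with all exponents equal to \<open>2\<close> has none larger. Recording for the edges between consecutive odd cycles which end is picked turns
  the coefficient of \<open>t\<close> into \<open>\<plusminus> trace (A\<^sup>2\<^sup>n)\<close>, where the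
  rows and columns of \<open>A\<close> are indexed by the possible sets of picks. Picking the opposite end of
  every edge of a cycle of odd length changes the sign, so \<open>A\<close> is real antisymmetric, and
  \<open>trace (A\<^sup>2\<^sup>n) = (-1)\<^sup>n \<parallel>A\<^sup>n\<parallel>\<^sup>2\<close> is nonzero because a nonzero antisymmetric matrix is not nilpotent.
\<close>

section \<open>Closed walks and antisymmetric matrices\<close>

text \<open>The (x, y) entry of A^n. Matrices are functions restricted to a set \<open>I\<close>,
  because the index set used later, \<open>Pow {..<a}\<close>, varies with the parameter
  \<open>a\<close>.\<close>

fun walk_weight :: "'a set \<Rightarrow> ('a \<Rightarrow> 'a \<Rightarrow> real) \<Rightarrow> nat \<Rightarrow> 'a \<Rightarrow> 'a \<Rightarrow> real" where
  "walk_weight I A 0 x y = of_bool (x = y)"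
| "walk_weight I A (Suc n) x y = (\<Sum>z\<in>I. walk_weight I A n x z * A z y)"

lemma sum_PiE_Suc:
  fixes F :: "(nat \<Rightarrow> 'a) \<Rightarrow> 'b::comm_monoid_add"
  shows "(\<Sum>T\<in>PiE {..<Suc n} (\<lambda>_. I). F T) =
    (\<Sum>T\<in>PiE {..<n} (\<lambda>_. I). \<Sum>y\<in>I. F (T(n := y)))"
proof -
  have "(\<Sum>T\<in>PiE {..<Suc n} (\<lambda>_. I). F T) = (\<Sum>(y, T)\<in>I \<times> PiE {..<n} (\<lambda>_. I). F (T(n := y)))"
    unfolding lessThan_Suc PiE_insert_eq
    by (subst sum.reindex[OF inj_combinator]) (auto simp: case_prod_unfold)
  also have "\<dots> = (\<Sum>T\<in>PiE {..<n} (\<lambda>_. I). \<Sum>y\<in>I. F (T(n := y)))"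
    by (simp add: sum.cartesian_product[symmetric]) (rule sum.swap)
  finally show ?thesis .
qed

text \<open>Induction sums out the last vertex and absorbs its step into the weight of the two ends,
  which is why \<open>f\<close> is arbitrary. The choice \<open>f x y = A y x\<close> later supplies
  the closing step of a closed walk.\<close>

lemma sum_walks:
  assumes "finite I"
  shows "(\<Sum>T\<in>PiE {..<Suc n} (\<lambda>_. I). f (T 0) (T n) * (\<Prod>j<n. A (T j) (T (Suc j)))) =
    (\<Sum>x\<in>I. \<Sum>y\<in>I. f x y * walk_weight I A n x y)"
proof (induction n arbitrary: f)
  case 0
  have "(\<Sum>y\<in>I. f x y * of_bool (x = y)) = f x x" if "x \<in> I" for x
  proof -
    have "I \<inter> {y. x = y} = {x}"
      using that by auto
    then show ?thesis
      using assms by simp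
  qed
  then show ?case
    by (subst sum_PiE_Suc) simp
next
  case (Suc n)
  have "(\<Sum>T\<in>PiE {..<Suc (Suc n)} (\<lambda>_. I).
        f (T 0) (T (Suc n)) * (\<Prod>j<Suc n. A (T j) (T (Suc j)))) =
      (\<Sum>T\<in>PiE {..<Suc n} (\<lambda>_. I).
        (\<Sum>y\<in>I. f (T 0) y * A (T n) y) * (\<Prod>j<n. A (T j) (T (Suc j))))"
    by (subst sum_PiE_Suc) (simp add: sum_distrib_left sum_distrib_right mult_ac)
  also have "\<dots> = (\<Sum>x\<in>I. \<Sum>z\<in>I. (\<Sum>y\<in>I. f x y * A z y) * walk_weight I A n x z)"
    by (rule Suc.IH)
  also have "\<dots> = (\<Sum>x\<in>I. \<Sum>y\<in>I. \<Sum>z\<in>I. f x y * A z y * walk_weight I A n x z)"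
    by (simp add: sum_distrib_right) (rule sum.cong[OF refl], rule sum.swap)
  also have "\<dots> = (\<Sum>x\<in>I. \<Sum>y\<in>I. f x y * walk_weight I A (Suc n) x y)"
    by (simp add: sum_distrib_left mult_ac)
  finally show ?case .
qed

lemma walk_weight_add:
  assumes "finite I" "y \<in> I"
  shows "walk_weight I A (m + n) x y = (\<Sum>z\<in>I. walk_weight I A m x z * walk_weight I A n z y)"
  using assms(2)
proof (induction n arbitrary: y)
  case 0
  then have "I \<inter> {z. z = y} = {y}"
    by auto
  then show ?case
    using assms(1) by simp
next
  case (Suc n)
  have "walk_weight I A (m + Suc n) x y =
      (\<Sum>z\<in>I. (\<Sum>u\<in>I. walk_weight I A m x u * walk_weight I A n u z) * A z y)"
    using Suc.IH by simp
  also have "\<dots> = (\<Sum>u\<in>I. \<Sum>z\<in>I. walk_weight I A m x u * walk_weight I A n u z * A z y)"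
    by (simp add: sum_distrib_right) (rule sum.swap)
  finally show ?case
    by (simp add: sum_distrib_left mult_ac)
qed

lemma walk_weight_Suc_0:
  assumes "finite I" "x \<in> I"
  shows "walk_weight I A (Suc 0) x y = A x y"
proof -
  have "I \<inter> {z. x = z} = {x}"
    using assms by auto
  then show ?thesis
    using assms by simp
qed

text \<open>The transpose of A^n is the n-th power of the transpose, that is, of -A.\<close>

lemma walk_weight_antisym:
  assumes "finite I" "\<forall>x\<in>I. \<forall>y\<in>I. A y x = - A x y" "x \<in> I" "y \<in> I"
  shows "walk_weight I A n y x = (-1) ^ n * walk_weight I A n x y"
  using assms(3,4)
proof (induction n arbitrary: x y)
  case 0
  then show ?case by (auto simp: of_bool_def)
next
  case (Suc n)
  have "walk_weight I A (Suc n) y x = (\<Sum>z\<in>I. walk_weight I A n y z * A z x)"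
    by simp
  also have "\<dots> = (\<Sum>z\<in>I. ((-1) ^ n * walk_weight I A n z y) * (- A x z))"
  proof (rule sum.cong[OF refl])
    fix z assume z: "z \<in> I"
    show "walk_weight I A n y z * A z x = ((-1) ^ n * walk_weight I A n z y) * (- A x z)"
      unfolding assms(2)[rule_format, OF Suc.prems(1) z] Suc.IH[OF z Suc.prems(2)] by (rule refl)
  qed
  \<comment> \<open>The recursion of \<open>walk_weight\<close> splits off the last step;
    transposing moves it to the front, hence \<open>walk_weight_add\<close> with
    \<open>m = Suc 0\<close>.\<close>
  also have "\<dots> = (-1) ^ Suc n * (\<Sum>z\<in>I. walk_weight I A (Suc 0) x z * walk_weight I A n z y)"
    using assms(1) Suc.prems
    by (simp add: walk_weight_Suc_0 sum_distrib_left sum_negf mult_ac del: walk_weight.simps)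
  also have "\<dots> = (-1) ^ Suc n * walk_weight I A (Suc n) x y"
    using walk_weight_add[OF assms(1) Suc.prems(2), where A = A and m = "Suc 0" and n = n and x = x]
    by simp
  finally show ?case .
qed

lemma walk_weight_double_diag:
  assumes "finite I" "\<forall>x\<in>I. \<forall>y\<in>I. A y x = - A x y" "x \<in> I"
  shows "walk_weight I A (n + n) x x = (-1) ^ n * (\<Sum>z\<in>I. (walk_weight I A n x z)\<^sup>2)"
proof -
  have "walk_weight I A (n + n) x x = (\<Sum>z\<in>I. walk_weight I A n x z * walk_weight I A n z x)"
    by (rule walk_weight_add[OF assms(1,3)])
  also have "\<dots> = (\<Sum>z\<in>I. (-1) ^ n * (walk_weight I A n x z)\<^sup>2)"
  proof (rule sum.cong[OF refl])
    fix z assume "z \<in> I"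
    have "walk_weight I A n z x = (-1) ^ n * walk_weight I A n x z"
      by (rule walk_weight_antisym[OF assms \<open>z \<in> I\<close>])
    then show "walk_weight I A n x z * walk_weight I A n z x = (-1) ^ n * (walk_weight I A n x z)\<^sup>2"
      by (simp only: power2_eq_square mult.left_commute)
  qed
  also have "\<dots> = (-1) ^ n * (\<Sum>z\<in>I. (walk_weight I A n x z)\<^sup>2)"
    by (rule sum_distrib_left[symmetric])
  finally show ?thesis .
qed

text \<open>
  If \<open>A\<^sup>n\<^sup>+\<^sup>1 = 0\<close> with \<open>n > 0\<close>, then \<open>A\<^sup>2\<^sup>n = 0\<close>, and its diagonal entries are up to sign the
  squared norms of the rows of \<open>A\<^sup>n\<close>.
\<close>

lemma antisym_walk_weight_nonzero:
  assumes I: "finite I" and anti: "\<forall>x\<in>I. \<forall>y\<in>I. A y x = - A x y"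
    and nz: "a \<in> I" "b \<in> I" "A a b \<noteq> 0"
  shows "\<exists>x\<in>I. \<exists>y\<in>I. walk_weight I A n x y \<noteq> 0"
proof (induction n)
  case 0
  show ?case using nz by auto
next
  case (Suc n)
  show ?case
  proof (cases "n = 0")
    case True
    then show ?thesis
      using walk_weight_Suc_0[OF I nz(1), of A b] nz by metis
  next
    case False
    from Suc obtain x y where xy: "x \<in> I" "y \<in> I" "walk_weight I A n x y \<noteq> 0"
      by blast
    then have "(\<Sum>z\<in>I. (walk_weight I A n x z)\<^sup>2) \<noteq> 0"
      using I by (auto simp: sum_nonneg_eq_0_iff)
    then have "walk_weight I A (n + n) x x \<noteq> 0"
      unfolding walk_weight_double_diag[OF I anti xy(1)] by simp
    moreover have "n + n = Suc n + (n - 1)"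
      using False by simp
    ultimately have "(\<Sum>z\<in>I. walk_weight I A (Suc n) x z * walk_weight I A (n - 1) z x) \<noteq> 0"
      by (simp only: walk_weight_add[OF I xy(1)] not_False_eq_True)
    then obtain z where "z \<in> I" "walk_weight I A (Suc n) x z * walk_weight I A (n - 1) z x \<noteq> 0"
      by (rule sum.not_neutral_contains_not_neutral)
    then show ?thesis
      using xy(1) by (metis mult_zero_left)
  qed
qed

lemma sum_closed_walks_nonzero:
  fixes A :: "'a \<Rightarrow> 'a \<Rightarrow> real"
  assumes I: "finite I" and anti: "\<forall>x\<in>I. \<forall>y\<in>I. A y x = - A x y"
    and nz: "a \<in> I" "b \<in> I" "A a b \<noteq> 0" and "n > 0"
  shows "(\<Sum>T\<in>PiE {..<2 * n} (\<lambda>_. I). \<Prod>j<2 * n. A (T j) (T (Suc j mod (2 * n)))) \<noteq> 0"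
proof -
  obtain l where l: "2 * n = Suc l"
    using \<open>n > 0\<close> by (cases "2 * n") auto
  \<comment> \<open>Only the factor with \<open>j = l\<close> wraps around; it is the closing step
    from \<open>T l\<close> to \<open>T 0\<close>, which turns the sum into the trace of
    A^(2n).\<close>
  have "(\<Prod>j<2 * n. A (T j) (T (Suc j mod (2 * n)))) =
      A (T l) (T 0) * (\<Prod>j<l. A (T j) (T (Suc j)))" for T :: "nat \<Rightarrow> 'a"
  proof -
    have "(\<Prod>j<l. A (T j) (T (Suc j mod Suc l))) = (\<Prod>j<l. A (T j) (T (Suc j)))"
      by (rule prod.cong) auto
    then show ?thesis
      unfolding l prod.lessThan_Suc by (simp only: mod_self mult.commute)
  qed
  then have "(\<Sum>T\<in>PiE {..<2 * n} (\<lambda>_. I). \<Prod>j<2 * n. A (T j) (T (Suc j mod (2 * n)))) =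
      (\<Sum>T\<in>PiE {..<Suc l} (\<lambda>_. I). A (T l) (T 0) * (\<Prod>j<l. A (T j) (T (Suc j))))"
    by (simp only: l)
  also have "\<dots> = (\<Sum>x\<in>I. \<Sum>y\<in>I. A y x * walk_weight I A l x y)"
    by (rule sum_walks[OF I])
  also have "\<dots> = (\<Sum>x\<in>I. walk_weight I A (n + n) x x)"
  proof -
    have "n + n = Suc l"
      using l by simp
    then show ?thesis
      by (simp only: walk_weight.simps mult.commute)
  qed
  also have "\<dots> = (-1) ^ n * (\<Sum>x\<in>I. \<Sum>z\<in>I. (walk_weight I A n x z)\<^sup>2)"
    using walk_weight_double_diag[OF I anti] by (simp add: sum_distrib_left)
  also have "\<dots> \<noteq> 0"
  proof -
    obtain x z where "x \<in> I" "z \<in> I" "walk_weight I A n x z \<noteq> 0"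
      using antisym_walk_weight_nonzero[OF I anti nz] by blast
    then have "(\<Sum>x\<in>I. \<Sum>z\<in>I. (walk_weight I A n x z)\<^sup>2) \<noteq> 0"
      using I by (auto simp: sum_nonneg_eq_0_iff sum_nonneg)
    then show ?thesis
      by simp
  qed
  finally show ?thesis .
qed

section \<open>Expanding products of differences of variables\<close>

lemma prod_single:
  fixes c :: "'a \<Rightarrow> 'b::comm_semiring_1" and t :: "'a \<Rightarrow> 'v::comm_monoid_add"
  shows "(\<Prod>x\<in>A. Poly_Mapping.single (t x) (c x)) =
    Poly_Mapping.single (\<Sum>x\<in>A. t x) (\<Prod>x\<in>A. c x)"
  by (induction A rule: infinite_finite_induct) (auto simp: mult_single)

text \<open>\<open>W\<close> collects the factors from which the first variable is taken; each other
  factor contributes a sign. Equal monomials stay uncollected, so cancellation can be studied on the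
  sets \<open>W\<close>.\<close>

lemma prod_mvar_diff:
  assumes "finite K"
  shows "(\<Prod>i\<in>K. mvar (a i) - mvar (b i)) =
    (\<Sum>W\<in>Pow K. Poly_Mapping.single
       (\<Sum>i\<in>K. Poly_Mapping.single (if i \<in> W then a i else b i) 1) ((-1) ^ card (K - W)))"
proof -
  have "(\<Prod>i\<in>K. mvar (a i) - mvar (b i)) = (\<Prod>i\<in>K. mvar (a i) + - mvar (b i))"
    by simp
  also have "\<dots> = (\<Sum>W\<in>Pow K. (\<Prod>i\<in>W. mvar (a i)) * (\<Prod>i\<in>K - W. - mvar (b i)))"
    by (rule prod_add[OF assms])
  also have "\<dots> = (\<Sum>W\<in>Pow K. Poly_Mapping.single
       (\<Sum>i\<in>K. Poly_Mapping.single (if i \<in> W then a i else b i) 1) ((-1) ^ card (K - W)))"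
  proof (rule sum.cong[OF refl])
    fix W assume W: "W \<in> Pow K"
    have "(\<Sum>i\<in>K. Poly_Mapping.single (if i \<in> W then a i else b i) 1) =
        (\<Sum>i\<in>K - W. Poly_Mapping.single (if i \<in> W then a i else b i) (1::nat)) +
        (\<Sum>i\<in>W. Poly_Mapping.single (if i \<in> W then a i else b i) 1)"
      using W assms by (intro sum.subset_diff) auto
    also have "\<dots> = (\<Sum>i\<in>W. Poly_Mapping.single (a i) 1) + (\<Sum>i\<in>K - W. Poly_Mapping.single (b i) 1)"
      by (subst add.commute, intro arg_cong2[of _ _ _ _ "(+)"] sum.cong) auto
    moreover have "(\<Prod>i\<in>K - W. - mvar (b i)) =
        Poly_Mapping.single (\<Sum>i\<in>K - W. Poly_Mapping.single (b i) 1) ((-1) ^ card (K - W))"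
      by (simp add: mvar_def single_uminus[symmetric] prod_single)
    ultimately show "(\<Prod>i\<in>W. mvar (a i)) * (\<Prod>i\<in>K - W. - mvar (b i)) =
      Poly_Mapping.single (\<Sum>i\<in>K. Poly_Mapping.single (if i \<in> W then a i else b i) 1)
        ((-1) ^ card (K - W))"
      by (simp add: mvar_def prod_single mult_single)
  qed
  finally show ?thesis .
qed

lemma prod_prod_mvar_diff:
  assumes "finite J" "finite K"
  shows "(\<Prod>j\<in>J. \<Prod>i\<in>K. mvar (a i j) - mvar (b i j)) =
    (\<Sum>W\<in>PiE J (\<lambda>_. Pow K). Poly_Mapping.single
       (\<Sum>j\<in>J. \<Sum>i\<in>K. Poly_Mapping.single (if i \<in> W j then a i j else b i j) 1)
       (\<Prod>j\<in>J. (-1) ^ card (K - W j)))"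
  using assms by (simp add: prod_mvar_diff prod_sum_PiE prod_single)

text \<open>Reversing an arc only negates its factor. So any orientation \<open>D\<close> of the
  edges may replace the one given by the vertex order, as far as vanishing of coefficients is
  concerned.\<close>

lemma graph_polynomial_orientation:
  fixes G :: "'v::linorder pair_pre_digraph"
  assumes "finite D" and parcs: "parcs G = D \<union> D\<inverse>" and "D \<inter> D\<inverse> = {}"
  defines "P \<equiv> \<Prod>(u, v)\<in>D. mvar u - mvar v"
  shows "graph_polynomial G = P \<or> graph_polynomial G = - P"
proof -
  let ?f = "\<lambda>(u, v). mvar u - mvar (v::'v)"
  define L where "L = {e \<in> D. fst e < snd e}"
  define R where "R = {e \<in> D. \<not> fst e < snd e}"
  have fin: "finite L" "finite R"
    using \<open>finite D\<close> by (auto simp: L_def R_def)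
  have neq: "u \<noteq> v" if "(u, v) \<in> D" for u v
    using that \<open>D \<inter> D\<inverse> = {}\<close> by blast
  have inc: "{(u, v) \<in> parcs G. u < v} = L \<union> prod.swap ` R"
  proof (intro set_eqI iffI)
    fix e assume "e \<in> {(u, v) \<in> parcs G. u < v}"
    then show "e \<in> L \<union> prod.swap ` R"
      by (force simp: parcs L_def R_def)
  next
    fix e assume "e \<in> L \<union> prod.swap ` R"
    then show "e \<in> {(u, v) \<in> parcs G. u < v}"
      using neq by (force simp: parcs L_def R_def)
  qed
  have disj: "L \<inter> prod.swap ` R = {}"
    using \<open>D \<inter> D\<inverse> = {}\<close> by (auto simp: L_def R_def)
  have "graph_polynomial G = prod ?f L * prod ?f (prod.swap ` R)"
    unfolding graph_polynomial_def inc using fin disj by (intro prod.union_disjoint) auto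
  also have "prod ?f (prod.swap ` R) = (\<Prod>e\<in>R. - ?f e)"
    by (subst prod.reindex) (auto intro!: prod.cong inj_onI simp: case_prod_unfold)
  also have "\<dots> = (-1) ^ card R * prod ?f R"
    by (rule prod_uminus)
  also have "prod ?f L * ((-1) ^ card R * prod ?f R) = (-1) ^ card R * P"
  proof -
    have "D = L \<union> R" "L \<inter> R = {}"
      by (auto simp: L_def R_def)
    then have "P = prod ?f L * prod ?f R"
      unfolding P_def using fin by (simp add: prod.union_disjoint)
    then show ?thesis
      by (simp add: mult_ac)
  qed
  finally show ?thesis
    using neg_one_even_power[of "card R"] neg_one_odd_power[of "card R"]
    by (cases "even (card R)") (auto simp: P_def)
qed

section \<open>The polynomial of a toroidal grid\<close>

definition cyc_succ :: "nat \<Rightarrow> nat \<Rightarrow> nat" where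
  "cyc_succ k i = Suc i mod k"

lemma cyc_succ_less: "i < k \<Longrightarrow> cyc_succ k i < k"
  by (simp add: cyc_succ_def)

lemma cyc_succ_eq_iff: "i < k \<Longrightarrow> i' < k \<Longrightarrow> cyc_succ k i = cyc_succ k i' \<longleftrightarrow> i = i'"
  by (auto simp: cyc_succ_def mod_Suc split: if_splits)

lemma bij_betw_cyc_succ: "bij_betw (cyc_succ k) {..<k} {..<k}"
  unfolding bij_betw_def by (intro conjI endo_inj_surj) (auto simp: inj_on_def cyc_succ_eq_iff cyc_succ_less)

lemma ball_cyc_succ_iff: "(\<forall>i\<in>{..<k}. P (cyc_succ k i)) \<longleftrightarrow> (\<forall>i\<in>{..<k}. P i)"
proof -
  have "(\<forall>i\<in>{..<k}. P (cyc_succ k i)) \<longleftrightarrow> (\<forall>i\<in>cyc_succ k ` {..<k}. P i)"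
    by simp
  then show ?thesis
    by (simp only: bij_betw_imp_surj_on[OF bij_betw_cyc_succ])
qed

lemma cyc_succ_neq: "k \<ge> 2 \<Longrightarrow> i < k \<Longrightarrow> cyc_succ k i \<noteq> i"
  by (auto simp: cyc_succ_def mod_Suc)

text \<open>For \<open>k = 2\<close> the arcs from \<open>i\<close> to \<open>cyc_succ k i\<close>
  would contain an edge in both directions; this excludes it and makes them an orientation.\<close>

lemma cyc_succ_cyc_succ_neq: "k \<ge> 3 \<Longrightarrow> i < k \<Longrightarrow> cyc_succ k (cyc_succ k i) \<noteq> i"
  by (auto simp: cyc_succ_def mod_Suc split: if_splits)

text \<open>
  The product over the arcs \<open>v \<rightarrow> v + 1\<close> in both directions, with factors shifted so that the two
  factors for \<open>(i, j)\<close> both contain the vertex \<open>(i + 1, j + 1)\<close>.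
\<close>

definition torus_polynomial :: "nat \<Rightarrow> nat \<Rightarrow> (nat \<times> nat) real_mpoly" where
  "torus_polynomial a b =
     (\<Prod>j<b. \<Prod>i<a. mvar (i, cyc_succ b j) - mvar (cyc_succ a i, cyc_succ b j)) *
     (\<Prod>j<b. \<Prod>i<a. mvar (cyc_succ a i, j) - mvar (cyc_succ a i, cyc_succ b j))"

lemma graph_polynomial_toroidal_grid:
  assumes "a \<ge> 3" "b \<ge> 3"
  shows "graph_polynomial (toroidal_grid a b) = torus_polynomial a b \<or>
    graph_polynomial (toroidal_grid a b) = - torus_polynomial a b"
proof -
  let ?V = "{..<a} \<times> {..<b}"
  let ?fV = "\<lambda>(i, j). ((i, j), (cyc_succ a i, j))"
  let ?fH = "\<lambda>(i, j). ((i, j), (i, cyc_succ b j))"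
  let ?d = "\<lambda>(u, v). mvar u - mvar (v :: nat \<times> nat)"
  \<comment> \<open>All edges are directed along \<open>cyc_succ\<close>. The wrap-around arcs
    decrease lexicographically, so this is not the orientation by the vertex order.\<close>
  define D where "D = ?fV ` ?V \<union> ?fH ` ?V"
  have D_iff: "((i, j), (i', j')) \<in> D \<longleftrightarrow>
      i < a \<and> j < b \<and> (i' = cyc_succ a i \<and> j' = j \<or> i' = i \<and> j' = cyc_succ b j)" for i j i' j'
    by (auto simp: D_def image_iff)
  have "finite D"
    by (simp add: D_def)
  moreover have "parcs (toroidal_grid a b) = D \<union> D\<inverse>"
  proof -
    have "((i, j), (i', j')) \<in> parcs (toroidal_grid a b) \<longleftrightarrow> ((i, j), (i', j')) \<in> D \<union> D\<inverse>"
      for i j i' j'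
      using cyc_succ_less[of i a] cyc_succ_less[of i' a] cyc_succ_less[of j b] cyc_succ_less[of j' b]
      unfolding Un_iff converse_iff D_iff
      by (auto simp: toroidal_grid_def cartesian_product_def cycle_graph_def cyc_succ_def)
    then show ?thesis
      by auto
  qed
  moreover have "D \<inter> D\<inverse> = {}"
  proof -
    have "\<not> (((i, j), (i', j')) \<in> D \<and> ((i', j'), (i, j)) \<in> D)" for i j i' j'
      unfolding D_iff
      using assms cyc_succ_neq[of a i] cyc_succ_neq[of b j] cyc_succ_neq[of a i'] cyc_succ_neq[of b j']
        cyc_succ_cyc_succ_neq[of a i] cyc_succ_cyc_succ_neq[of b j] by auto
    then show ?thesis
      by auto
  qed
  ultimately have "graph_polynomial (toroidal_grid a b) = prod ?d D \<or>
      graph_polynomial (toroidal_grid a b) = - prod ?d D"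
    by (rule graph_polynomial_orientation)
  moreover have "prod ?d D = torus_polynomial a b"
  proof -
    have "?fV ` ?V \<inter> ?fH ` ?V = {}"
      using assms cyc_succ_neq[of a] by (fastforce)
    then have "prod ?d D = prod ?d (?fV ` ?V) * prod ?d (?fH ` ?V)"
      unfolding D_def by (intro prod.union_disjoint) auto
    also have "prod ?d (?fV ` ?V) = (\<Prod>i<a. \<Prod>j<b. mvar (i, j) - mvar (cyc_succ a i, j))"
      by (subst prod.reindex)
        (auto intro!: inj_onI prod.cong simp: prod.cartesian_product)
    also have "\<dots> = (\<Prod>j<b. \<Prod>i<a. mvar (i, j) - mvar (cyc_succ a i, j))"
      by (rule prod.swap)
    also have "\<dots> = (\<Prod>j<b. \<Prod>i<a. mvar (i, cyc_succ b j) - mvar (cyc_succ a i, cyc_succ b j))"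
      by (rule prod.reindex_bij_betw[OF bij_betw_cyc_succ, symmetric])
    also have "prod ?d (?fH ` ?V) = (\<Prod>i<a. \<Prod>j<b. mvar (i, j) - mvar (i, cyc_succ b j))"
      by (subst prod.reindex)
        (auto intro!: inj_onI prod.cong simp: prod.cartesian_product)
    also have "\<dots> = (\<Prod>i<a. \<Prod>j<b. mvar (cyc_succ a i, j) - mvar (cyc_succ a i, cyc_succ b j))"
      by (rule prod.reindex_bij_betw[OF bij_betw_cyc_succ, symmetric])
    also have "\<dots> = (\<Prod>j<b. \<Prod>i<a. mvar (cyc_succ a i, j) - mvar (cyc_succ a i, cyc_succ b j))"
      by (rule prod.swap)
    finally show ?thesis
      by (simp add: torus_polynomial_def)
  qed
  ultimately show ?thesis
    by simp
qed

abbreviation row_families :: "nat \<Rightarrow> nat \<Rightarrow> (nat \<Rightarrow> nat set) set" where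
  "row_families a b \<equiv> PiE {..<b} (\<lambda>_. Pow {..<a})"

text \<open>\<open>W j\<close> holds the picks on the cycle with second coordinate
  \<open>cyc_succ b j\<close>, and \<open>T j\<close> those on the edges from cycle \<open>j\<close>
  to cycle \<open>cyc_succ b j\<close>, where \<open>i\<close> stands for the column
  \<open>cyc_succ a i\<close>.\<close>

definition torus_exponent ::
    "nat \<Rightarrow> nat \<Rightarrow> (nat \<Rightarrow> nat set) \<Rightarrow> (nat \<Rightarrow> nat set) \<Rightarrow> nat \<times> nat \<Rightarrow>\<^sub>0 nat" where
  "torus_exponent a b W T =
     (\<Sum>j<b. \<Sum>i<a. Poly_Mapping.single
        (if i \<in> W j then (i, cyc_succ b j) else (cyc_succ a i, cyc_succ b j)) 1) +
     (\<Sum>j<b. \<Sum>i<a. Poly_Mapping.single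
        (if i \<in> T j then (cyc_succ a i, j) else (cyc_succ a i, cyc_succ b j)) 1)"

text \<open>The sum over \<open>T\<close> is outermost because, once the picks between cycles are
  fixed, the picks on different cycles can be summed independently.\<close>

lemma torus_polynomial_expand:
  "torus_polynomial a b =
    (\<Sum>T\<in>row_families a b. \<Sum>W\<in>row_families a b. Poly_Mapping.single (torus_exponent a b W T)
       (\<Prod>j<b. (-1) ^ card ({..<a} - W j) * (-1) ^ card ({..<a} - T j)))"
proof -
  have "torus_polynomial a b =
    (\<Sum>W\<in>row_families a b. \<Sum>T\<in>row_families a b. Poly_Mapping.single (torus_exponent a b W T)
       (\<Prod>j<b. (-1) ^ card ({..<a} - W j) * (-1) ^ card ({..<a} - T j)))"
    by (simp only: torus_polynomial_def prod_prod_mvar_diff finite_lessThan sum_product mult_single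
        torus_exponent_def prod.distrib)
  then show ?thesis
    by (rule trans[OF _ sum.swap])
qed

text \<open>Homogeneity: each of the 2ab factors contributes exactly one variable of the
  grid.\<close>

lemma sum_torus_exponent:
  "(\<Sum>v\<in>{..<a} \<times> {..<b}. Poly_Mapping.lookup (torus_exponent a b W T) v) = 2 * (a * b)"
proof -
  have one: "(\<Sum>v\<in>{..<a} \<times> {..<b}. Poly_Mapping.lookup (Poly_Mapping.single u (1::nat)) v) = 1"
    if "u \<in> {..<a} \<times> {..<b}" for u
    using that by (simp add: lookup_single when_def)
  have "(\<Sum>v\<in>{..<a} \<times> {..<b}. Poly_Mapping.lookup (\<Sum>j<b. \<Sum>i<a. Poly_Mapping.single (f i j) (1::nat)) v) = a * b"
    if "\<And>i j. i < a \<Longrightarrow> j < b \<Longrightarrow> f i j \<in> {..<a} \<times> {..<b}" for f :: "nat \<Rightarrow> nat \<Rightarrow> nat \<times> nat"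
  proof -
    have "(\<Sum>v\<in>{..<a} \<times> {..<b}. Poly_Mapping.lookup (\<Sum>j<b. \<Sum>i<a. Poly_Mapping.single (f i j) (1::nat)) v) =
      (\<Sum>j<b. \<Sum>i<a. \<Sum>v\<in>{..<a} \<times> {..<b}. Poly_Mapping.lookup (Poly_Mapping.single (f i j) (1::nat)) v)"
      unfolding lookup_sum
      by (subst sum.swap, intro sum.cong[OF refl], subst sum.swap, rule refl)
    also have "\<dots> = (\<Sum>j<b. \<Sum>i<a. 1)"
      using that by (intro sum.cong refl one) auto
    finally show ?thesis
      by simp
  qed
  from this[of "\<lambda>i j. if i \<in> W j then (i, cyc_succ b j) else (cyc_succ a i, cyc_succ b j)"]
    this[of "\<lambda>i j. if i \<in> T j then (cyc_succ a i, j) else (cyc_succ a i, cyc_succ b j)"]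
  show ?thesis
    by (simp add: torus_exponent_def lookup_add sum.distrib cyc_succ_less)
qed

text \<open>Four factor positions involve this vertex: along its cycle it is the first end at index
  \<open>cyc_succ a i\<close> and the second end at \<open>i\<close>; across cycles it is the first
  end at \<open>cyc_succ b j\<close> and the second end at \<open>j\<close>.\<close>

lemma lookup_torus_exponent:
  assumes ij: "i < a" "j < b"
  shows "Poly_Mapping.lookup (torus_exponent a b W T) (cyc_succ a i, cyc_succ b j) =
    of_bool (cyc_succ a i \<in> W j) + of_bool (i \<notin> W j) +
    of_bool (i \<in> T (cyc_succ b j)) + of_bool (i \<notin> T j)"
proof -
  let ?v = "(cyc_succ a i, cyc_succ b j)"
  have "Poly_Mapping.lookup (\<Sum>j<b. \<Sum>i<a. Poly_Mapping.single
        (if i \<in> W j then (i, cyc_succ b j) else (cyc_succ a i, cyc_succ b j)) (1::nat)) ?v =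
      (\<Sum>j'<b. \<Sum>i'<a. if j' = j then
         (if i' = cyc_succ a i then of_bool (i' \<in> W j') else 0) +
         (if i' = i then of_bool (i' \<notin> W j') else 0) else 0)"
    unfolding lookup_sum using ij
    by (intro sum.cong refl) (auto simp: lookup_single when_def cyc_succ_eq_iff)
  also have "\<dots> = (\<Sum>j'<b. if j' = j then \<Sum>i'<a.
         (if i' = cyc_succ a i then of_bool (i' \<in> W j') else 0) +
         (if i' = i then of_bool (i' \<notin> W j') else 0) else 0)"
    by (intro sum.cong) auto
  also have "\<dots> = of_bool (cyc_succ a i \<in> W j) + of_bool (i \<notin> W j)"
    using ij by (simp add: sum.distrib cyc_succ_less)
  finally have V: "Poly_Mapping.lookup (\<Sum>j<b. \<Sum>i<a. Poly_Mapping.single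
        (if i \<in> W j then (i, cyc_succ b j) else (cyc_succ a i, cyc_succ b j)) (1::nat)) ?v =
      of_bool (cyc_succ a i \<in> W j) + of_bool (i \<notin> W j)" .
  have "Poly_Mapping.lookup (\<Sum>j<b. \<Sum>i<a. Poly_Mapping.single
        (if i \<in> T j then (cyc_succ a i, j) else (cyc_succ a i, cyc_succ b j)) (1::nat)) ?v =
      (\<Sum>j'<b. \<Sum>i'<a. if i' = i then
         (if j' = cyc_succ b j then of_bool (i \<in> T j') else 0) +
         (if j' = j then of_bool (i \<notin> T j') else 0) else 0)"
    unfolding lookup_sum using ij
    by (intro sum.cong refl) (auto simp: lookup_single when_def cyc_succ_eq_iff)
  also have "\<dots> = (\<Sum>j'<b.
         (if j' = cyc_succ b j then of_bool (i \<in> T j') else 0) +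
         (if j' = j then of_bool (i \<notin> T j') else 0))"
    using ij by simp
  also have "\<dots> = of_bool (i \<in> T (cyc_succ b j)) + of_bool (i \<notin> T j)"
    using ij by (simp add: sum.distrib cyc_succ_less)
  finally have H: "Poly_Mapping.lookup (\<Sum>j<b. \<Sum>i<a. Poly_Mapping.single
        (if i \<in> T j then (cyc_succ a i, j) else (cyc_succ a i, cyc_succ b j)) (1::nat)) ?v =
      of_bool (i \<in> T (cyc_succ b j)) + of_bool (i \<notin> T j)" .
  show ?thesis
    unfolding torus_exponent_def lookup_add V H by (simp only: add.assoc)
qed

lemma lookup_torus_exponent_outside:
  "v \<notin> {..<a} \<times> {..<b} \<Longrightarrow> Poly_Mapping.lookup (torus_exponent a b W T) v = 0"
  by (auto simp: torus_exponent_def lookup_add lookup_sum lookup_single when_def cyc_succ_less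
      intro!: sum.neutral)

section \<open>The transfer matrix of a layer\<close>

text \<open>
  For one cycle \<open>C\<^sub>a\<close>, the sets \<open>S\<close>, \<open>T\<close> and \<open>W\<close> consist of the edges towards the previous cycle, towards
  the next cycle and on the cycle itself for which the first end is picked; the condition says that
  every vertex is picked twice. The index \<open>i\<close> refers to the vertex \<open>cyc_succ a i\<close>, which
  avoids predecessors modulo \<open>a\<close>.
\<close>

definition balanced :: "nat \<Rightarrow> nat set \<Rightarrow> nat set \<Rightarrow> nat set \<Rightarrow> bool" where
  "balanced a S T W \<longleftrightarrow> (\<forall>i<a. of_bool (cyc_succ a i \<in> W) + of_bool (i \<notin> W) +
     of_bool (i \<in> T) + of_bool (i \<notin> S) = (2 :: nat))"

text \<open>The signed number of ways to complete given picks on both sides of a cycle; every second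
  end picked on the cycle contributes -1.\<close>

definition layer_sum :: "nat \<Rightarrow> nat set \<Rightarrow> nat set \<Rightarrow> real" where
  "layer_sum a S T = (\<Sum>W\<in>Pow {..<a}. (-1) ^ card ({..<a} - W) * of_bool (balanced a S T W))"

text \<open>The matrix A of the opening comment. Only the sign of \<open>S\<close> is included:
  around the torus each set between two cycles is the \<open>S\<close> of exactly one layer, so
  every sign is counted once.\<close>

definition transfer :: "nat \<Rightarrow> nat set \<Rightarrow> nat set \<Rightarrow> real" where
  "transfer a S T = (-1) ^ card ({..<a} - S) * layer_sum a S T"

lemma sum_of_bool_mem: "S \<subseteq> {..<a} \<Longrightarrow> (\<Sum>i<a. of_bool (i \<in> S)) = card S" for a :: nat
  by (simp add: Int_absorb1)

text \<open>Double counting: summed over the cycle, the two terms with \<open>W\<close> give a, one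
  pick per edge. What remains is |T| + (a - |S|) = a.\<close>

lemma balanced_imp_card_eq:
  assumes "balanced a S T W" and sub: "S \<subseteq> {..<a}" "T \<subseteq> {..<a}" "W \<subseteq> {..<a}"
  shows "card S = card T"
proof -
  have compl: "(\<Sum>i<a. of_bool (i \<notin> X)) + (\<Sum>i<a. of_bool (i \<in> X)) = a" for X :: "nat set"
  proof -
    have "(\<Sum>i<a. of_bool (i \<notin> X) + of_bool (i \<in> X)) = (\<Sum>i<a. 1 :: nat)"
      by (rule sum.cong) auto
    then show ?thesis
      by (simp add: sum.distrib del: sum_of_bool_eq)
  qed
  have "(\<Sum>i<a. of_bool (cyc_succ a i \<in> W)) = (\<Sum>i<a. of_bool (i \<in> W) :: nat)"
    by (rule sum.reindex_bij_betw[OF bij_betw_cyc_succ])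
  moreover have "(\<Sum>i<a. of_bool (cyc_succ a i \<in> W) + of_bool (i \<notin> W) +
      of_bool (i \<in> T) + of_bool (i \<notin> S)) = (\<Sum>i<a. 2 :: nat)"
    using assms(1) by (intro sum.cong) (auto simp: balanced_def)
  then have "(\<Sum>i<a. of_bool (cyc_succ a i \<in> W)) + (\<Sum>i<a. of_bool (i \<notin> W)) +
      (\<Sum>i<a. of_bool (i \<in> T)) + (\<Sum>i<a. of_bool (i \<notin> S)) = 2 * a"
    by (simp add: sum.distrib del: sum_of_bool_eq)
  ultimately have "(\<Sum>i<a. of_bool (i \<in> T)) = (\<Sum>i<a. of_bool (i \<in> S) :: nat)"
    using compl[of W] compl[of S] by linarith
  then show ?thesis
    unfolding sum_of_bool_mem[OF sub(1)] sum_of_bool_mem[OF sub(2)] by simp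
qed

text \<open>Picking the opposite end everywhere replaces the count c at a vertex by 4 - c, and 2 is
  the fixed point.\<close>

lemma balanced_complement:
  "balanced a T S ({..<a} - W) \<longleftrightarrow> balanced a S T W"
  unfolding balanced_def by (intro all_cong) (auto simp: cyc_succ_less)

text \<open>Complementing \<open>W\<close> is a bijection between the balanced sets for the two
  orders. Since |W| and the size of its complement add up to the odd number a, each sign
  flips.\<close>

lemma layer_sum_swap:
  assumes "odd a"
  shows "layer_sum a T S = - layer_sum a S T"
proof -
  have "layer_sum a T S = (\<Sum>W\<in>Pow {..<a}.
      (-1) ^ card ({..<a} - ({..<a} - W)) * of_bool (balanced a T S ({..<a} - W)))"
    unfolding layer_sum_def
    by (rule sum.reindex_bij_witness[of _ "\<lambda>W. {..<a} - W" "\<lambda>W. {..<a} - W"])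
      (auto simp: double_diff)
  also have "\<dots> = (\<Sum>W\<in>Pow {..<a}. - ((-1) ^ card ({..<a} - W) * of_bool (balanced a S T W)))"
  proof (rule sum.cong[OF refl])
    fix W assume "W \<in> Pow {..<a}"
    then have W: "W \<subseteq> {..<a}"
      by simp
    then have "card W \<le> a"
      using card_mono[OF _ W] by simp
    then have "card ({..<a} - W) + card W = a"
      using W by (simp add: card_Diff_subset finite_subset)
    then have "even (card W) \<longleftrightarrow> odd (card ({..<a} - W))"
      using assms even_add by metis
    moreover have "{..<a} - ({..<a} - W) = W"
      using W by auto
    ultimately show "(-1) ^ card ({..<a} - ({..<a} - W)) * of_bool (balanced a T S ({..<a} - W)) =
        - ((-1) ^ card ({..<a} - W) * of_bool (balanced a S T W) :: real)"
      unfolding balanced_complement by (cases "even (card W)") simp_all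
  qed
  finally show ?thesis
    by (simp add: layer_sum_def sum_negf)
qed

text \<open>The sign factor depends on \<open>S\<close> alone, but entries vanish unless
  \<open>S\<close> and \<open>T\<close> have the same size, in which case both sign factors
  agree.\<close>

lemma transfer_antisym:
  assumes "odd a" "S \<subseteq> {..<a}" "T \<subseteq> {..<a}"
  shows "transfer a T S = - transfer a S T"
proof (cases "card S = card T")
  case True
  then have "card ({..<a} - S) = card ({..<a} - T)"
    using assms by (simp add: card_Diff_subset finite_subset)
  then show ?thesis
    using layer_sum_swap[OF assms(1), of T S] by (simp add: transfer_def)
next
  case False
  then have "layer_sum a S T = 0"
    unfolding layer_sum_def using assms balanced_imp_card_eq by (intro sum.neutral) auto
  then show ?thesis
    using layer_sum_swap[OF assms(1), of T S] by (simp add: transfer_def)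
qed

text \<open>An entry with a single summand cannot cancel. The condition at 0 forces
  \<open>1 \<in> W\<close> and \<open>0 \<notin> W\<close>, the one at 1 forces
  \<open>2 \<notin> W\<close>, and those from 2 on pass non-membership to the successor.\<close>

lemma balanced_singletons_iff:
  assumes "a \<ge> 3" "W \<subseteq> {..<a}"
  shows "balanced a {0} {1} W \<longleftrightarrow> W = {1}"
proof
  assume bal: "balanced a {0} {1} W"
  have at: "of_bool (cyc_succ a i \<in> W) + of_bool (i \<notin> W) +
      of_bool (i \<in> {1::nat}) + of_bool (i \<notin> {0::nat}) = (2 :: nat)" if "i < a" for i
    using bal that by (simp add: balanced_def)
  have W01: "1 \<in> W \<and> 0 \<notin> W"
    using at[of 0] assms(1) by (cases "0 \<in> W"; cases "Suc 0 \<in> W") (simp_all add: cyc_succ_def)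
  have W2: "i \<notin> W" if "2 \<le> i" "i < a" for i
    using that
  proof (induction i rule: dec_induct)
    case base
    then show ?case
      using at[of 1] assms(1) W01 by (cases "2 \<in> W") (simp_all add: cyc_succ_def numeral_2_eq_2)
  next
    case (step i)
    then show ?case
      using at[of i] by (cases "Suc i \<in> W") (simp_all add: cyc_succ_def)
  qed
  show "W = {1}"
  proof (intro equalityI subsetI)
    fix i assume "i \<in> W"
    then have "\<not> 2 \<le> i"
      using W2[of i] assms(2) by auto
    moreover have "i \<noteq> 0"
      using W01 \<open>i \<in> W\<close> by metis
    ultimately show "i \<in> {1}"
      by simp
  qed (use W01 in simp)
next
  assume "W = {1}"
  then show "balanced a {0} {1} W"
    unfolding balanced_def
  proof (intro allI impI)
    fix i assume "i < a"
    consider "i = 0" | "i = 1" | "i \<ge> 2"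
      by linarith
    then show "of_bool (cyc_succ a i \<in> W) + of_bool (i \<notin> W) +
        of_bool (i \<in> {1}) + of_bool (i \<notin> {0}) = (2 :: nat)"
      using assms(1) \<open>W = {1}\<close> \<open>i < a\<close> by cases (simp_all add: cyc_succ_def mod_Suc)
  qed
qed

lemma transfer_nonzero:
  assumes "a \<ge> 3"
  shows "transfer a {0} {1} \<noteq> 0"
proof -
  have "layer_sum a {0} {1} = (\<Sum>W\<in>Pow {..<a}. if W = {1} then (-1) ^ card ({..<a} - W) else 0)"
    unfolding layer_sum_def using balanced_singletons_iff[OF assms]
    by (intro sum.cong) auto
  then show ?thesis
    using assms by (simp add: transfer_def)
qed

section \<open>The coefficient of the monomial with all exponents 2\<close>

lemma torus_exponent_eq_iff:
  assumes "t = (\<Sum>v\<in>{..<a} \<times> {..<b}. Poly_Mapping.single v 2)"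
  shows "torus_exponent a b W T = t \<longleftrightarrow> (\<forall>j<b. balanced a (T j) (T (cyc_succ b j)) (W j))"
proof -
  have t: "Poly_Mapping.lookup t v = (if v \<in> {..<a} \<times> {..<b} then 2 else 0)" for v
    unfolding assms lookup_sum lookup_single when_def by simp
  have "torus_exponent a b W T = t \<longleftrightarrow>
      (\<forall>v\<in>{..<a} \<times> {..<b}. Poly_Mapping.lookup (torus_exponent a b W T) v = 2)"
    (is "_ \<longleftrightarrow> ?R")
  proof
    assume R: ?R
    show "torus_exponent a b W T = t"
    proof (rule poly_mapping_eqI)
      fix v
      show "Poly_Mapping.lookup (torus_exponent a b W T) v = Poly_Mapping.lookup t v"
      proof (cases "v \<in> {..<a} \<times> {..<b}")
        case True
        then show ?thesis
          using bspec[OF R True] by (simp only: t if_True)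
      next
        case False
        then show ?thesis
          using lookup_torus_exponent_outside[OF False, of W T] by (simp only: t if_False)
      qed
    qed
  qed (simp add: t)
  also have "\<dots> \<longleftrightarrow> (\<forall>i\<in>{..<a}. \<forall>j\<in>{..<b}. Poly_Mapping.lookup (torus_exponent a b W T) (i, j) = 2)"
    by auto
  \<comment> \<open>Both coordinates are shifted along the bijection \<open>cyc_succ\<close>, to
    match \<open>lookup_torus_exponent\<close>. The count then involves only \<open>W j\<close>,
    \<open>T j\<close> and \<open>T (cyc_succ b j)\<close>, so the condition splits into
    layers.\<close>
  also have "\<dots> \<longleftrightarrow> (\<forall>i\<in>{..<a}. \<forall>j\<in>{..<b}.
      Poly_Mapping.lookup (torus_exponent a b W T) (cyc_succ a i, cyc_succ b j) = 2)"
    unfolding ball_cyc_succ_iff[of b "\<lambda>j. Poly_Mapping.lookup _ (_, j) = 2"]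
      ball_cyc_succ_iff[of a "\<lambda>i. \<forall>j\<in>{..<b}. Poly_Mapping.lookup _ (i, j) = 2"] by (rule refl)
  also have "\<dots> \<longleftrightarrow> (\<forall>i\<in>{..<a}. \<forall>j\<in>{..<b}.
      of_bool (cyc_succ a i \<in> W j) + of_bool (i \<notin> W j) +
      of_bool (i \<in> T (cyc_succ b j)) + of_bool (i \<notin> T j) = (2 :: nat))"
    by (intro ball_cong refl) (simp only: lookup_torus_exponent lessThan_iff)
  also have "\<dots> \<longleftrightarrow> (\<forall>j<b. balanced a (T j) (T (cyc_succ b j)) (W j))"
  proof -
    have swap: "(\<forall>i\<in>{..<a}. \<forall>j\<in>{..<b}. Q i j) \<longleftrightarrow> (\<forall>j<b. \<forall>i<a. Q i j)" for Q
      by auto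
    show ?thesis
      unfolding balanced_def by (rule swap)
  qed
  finally show ?thesis .
qed

lemma lookup_torus_polynomial:
  assumes "t = (\<Sum>v\<in>{..<a} \<times> {..<b}. Poly_Mapping.single v 2)"
  shows "Poly_Mapping.lookup (torus_polynomial a b) t =
    (\<Sum>T\<in>row_families a b. \<Prod>j<b. transfer a (T j) (T (cyc_succ b j)))"
proof -
  \<comment> \<open>Writing the indicator as a product over layers, like the sign, lets the sum over
    \<open>W\<close> factor layer by layer for fixed \<open>T\<close>.\<close>
  have of_bool_all: "of_bool (\<forall>j<b. Q j) = (\<Prod>j<b. of_bool (Q j) :: real)" for Q
    by (cases "\<forall>j<b. Q j") (auto simp: prod_zero_iff)
  have "Poly_Mapping.lookup (torus_polynomial a b) t =
      (\<Sum>T\<in>row_families a b. \<Sum>W\<in>row_families a b.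
        (\<Prod>j<b. (-1) ^ card ({..<a} - W j) * (-1) ^ card ({..<a} - T j)) *
        of_bool (torus_exponent a b W T = t))"
    unfolding torus_polynomial_expand lookup_sum lookup_single
    by (intro sum.cong refl) (simp add: when_def)
  also have "\<dots> = (\<Sum>T\<in>row_families a b. \<Sum>W\<in>row_families a b. \<Prod>j<b.
        (-1) ^ card ({..<a} - W j) * (-1) ^ card ({..<a} - T j) *
        of_bool (balanced a (T j) (T (cyc_succ b j)) (W j)))"
    unfolding torus_exponent_eq_iff[OF assms] of_bool_all prod.distrib by (rule refl)
  also have "\<dots> = (\<Sum>T\<in>row_families a b. \<Prod>j<b. \<Sum>W\<in>Pow {..<a}.
        (-1) ^ card ({..<a} - W) * (-1) ^ card ({..<a} - T j) *
        of_bool (balanced a (T j) (T (cyc_succ b j)) W))"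
    by (intro sum.cong refl prod_sum_PiE[symmetric]) auto
  also have "\<dots> = (\<Sum>T\<in>row_families a b. \<Prod>j<b. transfer a (T j) (T (cyc_succ b j)))"
    by (simp add: transfer_def layer_sum_def sum_distrib_left mult_ac del: sum_mult_of_bool_eq)
  finally show ?thesis .
qed

section \<open>The two bounds on the Alon-Tarsi number\<close>

lemma alon_tarsi_choosable_toroidal_grid_3:
  assumes "odd a" "a \<ge> 3" "n \<ge> 2"
  shows "alon_tarsi_choosable 3 (toroidal_grid a (2 * n))"
proof -
  let ?G = "toroidal_grid a (2 * n)"
  define t where "t = (\<Sum>v\<in>{..<a} \<times> {..<2 * n}. Poly_Mapping.single v (2::nat))"
  have anti: "\<forall>S\<in>Pow {..<a}. \<forall>T\<in>Pow {..<a}. transfer a T S = - transfer a S T"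
    using transfer_antisym[OF assms(1)] by blast
  \<comment> \<open>The families \<open>T\<close> are closed walks of even length 2n on the subsets
    of \<open>{..<a}\<close>; the nonzero entry needed is the one at \<open>{0}\<close> and
    \<open>{1}\<close>.\<close>
  have "(\<Sum>T\<in>row_families a (2 * n). \<Prod>j<2 * n. transfer a (T j) (T (Suc j mod (2 * n)))) \<noteq> 0"
    by (rule sum_closed_walks_nonzero[where A = "transfer a", OF _ anti _ _ transfer_nonzero[OF assms(2)]])
      (use assms in auto)
  then have "Poly_Mapping.lookup (torus_polynomial a (2 * n)) t \<noteq> 0"
    unfolding lookup_torus_polynomial[OF t_def] cyc_succ_def .
  then have "Poly_Mapping.lookup (graph_polynomial ?G) t \<noteq> 0"
    using graph_polynomial_toroidal_grid[of a "2 * n"] assms by auto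
  moreover have "Poly_Mapping.lookup t v < 3" for v
    unfolding t_def lookup_sum lookup_single when_def by simp
  ultimately show ?thesis
    unfolding alon_tarsi_choosable_def by blast
qed

text \<open>Averaging: the exponents of a monomial sum to 2ab over ab vertices, so they cannot all
  be at most 1.\<close>

lemma alon_tarsi_choosable_toroidal_grid_ge:
  assumes "a \<ge> 3" "b \<ge> 3" "alon_tarsi_choosable k (toroidal_grid a b)"
  shows "k \<ge> 3"
proof (rule ccontr)
  assume "\<not> k \<ge> 3"
  obtain t where t: "Poly_Mapping.lookup (graph_polynomial (toroidal_grid a b)) t \<noteq> 0"
    and less: "\<And>v. v \<in> {..<a} \<times> {..<b} \<Longrightarrow> Poly_Mapping.lookup t v < k"
    using assms(3) unfolding alon_tarsi_choosable_def
    by (auto simp: toroidal_grid_def cartesian_product_def cycle_graph_def)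
  have nz: "Poly_Mapping.lookup (torus_polynomial a b) t \<noteq> 0"
    using t graph_polynomial_toroidal_grid[OF assms(1,2)] by auto
  \<comment> \<open>A monomial with nonzero coefficient must already occur in the uncollected
    expansion, which gives access to its degree.\<close>
  have "\<exists>W T. torus_exponent a b W T = t"
  proof (rule ccontr)
    assume "\<nexists>W T. torus_exponent a b W T = t"
    then have "Poly_Mapping.lookup (torus_polynomial a b) t = 0"
      by (simp add: torus_polynomial_expand lookup_sum lookup_single when_def)
    with nz show False
      by simp
  qed
  then obtain W T where "t = torus_exponent a b W T"
    by blast
  then have "2 * (a * b) = (\<Sum>v\<in>{..<a} \<times> {..<b}. Poly_Mapping.lookup t v)"
    by (simp add: sum_torus_exponent)
  also have "\<dots> \<le> (\<Sum>v\<in>{..<a} \<times> {..<b}. 1)"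
  proof (rule sum_mono)
    fix v assume "v \<in> {..<a} \<times> {..<b}"
    from less[OF this] show "Poly_Mapping.lookup t v \<le> 1"
      using \<open>\<not> k \<ge> 3\<close> by linarith
  qed
  finally show False
    using assms by simp
qed

theorem mainTheorem3:
  fixes m n :: nat
  assumes "m \<ge> 1" and "n \<ge> 2"
  shows "alon_tarsi_number (toroidal_grid (2 * m + 1) (2 * n)) = 3"
  unfolding alon_tarsi_number_def
proof (rule Least_equality)
  show "alon_tarsi_choosable 3 (toroidal_grid (2 * m + 1) (2 * n))"
    by (rule alon_tarsi_choosable_toroidal_grid_3) (use assms in auto)
  show "3 \<le> k" if "alon_tarsi_choosable k (toroidal_grid (2 * m + 1) (2 * n))" for k
    by (rule alon_tarsi_choosable_toroidal_grid_ge[OF _ _ that]) (use assms in auto)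
qed

end
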